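(* Let $f,g,h$ be smooth real-valued functions of $(x^{1},x^{2},x^{3})$ vanishing at $(0,0,0)$, and consider the three-dimensional dynamical system $$\frac{dx^{1}}{dt}=f(x^{1},x^{2},x^{3}),\quad \frac{dx^{2}}{dt}=g(x^{1},x^{2},x^{3}),\quad \frac{dx^{3}}{dt}=h(x^{1},x^{2},x^{3}),$$ with fixed point $(0,0,0)$. Then this fixed point is Jacobi unstable, regardless of its Lyapunov stability.
   Context: For a second order system $\frac{d^{2}x^{i}}{dt^{2}}+2G^{i}(x,y,t)=0$, $i=1,\dots,n$, with $y^{i}=\frac{dx^{i}}{dt}$ and $G^i$ smooth functions of the independent coordinates $(x,y,t)$, define $N^{i}_{j}=\frac{\partial G^{i}}{\partial y^{j}}$, $G^{i}_{jl}=\frac{\partial N^{i}_{j}}{\partial y^{l}}$, and the curvature deviation tensor (summation over the repeated index $l$) $$P^{i}_{j}=-2\frac{\partial G^{i}}{\partial x^{j}}-2G^{l}G^{i}_{jl}+y^{l}\frac{\partial N^{i}_{j}}{\partial x^{l}}+N^{i}_{l}N^{l}_{j}+\frac{\partial N^{i}_{j}}{\partial t}.$$ The curvature deviation tensor $P=(P^{i}_{j})$ of a first order system $\frac{dx^{i}}{dt}=f^{i}(x)$ (here $n=3$ and $(f^{1},f^{2},f^{3})=(f,g,h)$) is that of the second order system obtained by differentiating it once with respect to $t$, i.e. the one with $G^{i}(x,y)=-\frac12\sum_{k=1}^{n}\frac{\partial f^{i}}{\partial x^{k}}(x)\,y^{k}$. $P|_{(0,0,0)}$ denotes the matrix $(P^{i}_{j})$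 evaluated at $x=0$, $y=0$ (at a fixed point $y^{i}=f^{i}=0$). The fixed point $(0,0,0)$ is called Jacobi stable if all eigenvalues of $P|_{(0,0,0)}$ have strictly negative real part, and Jacobi unstable otherwise. *)

theory Defs
  imports "HOL-Analysis.Analysis"
begin

definition partial :: "'n \<Rightarrow> (real ^ 'n \<Rightarrow> real) \<Rightarrow> real ^ 'n \<Rightarrow> real" where
  "partial i u x = deriv (\<lambda>s. u (x + s *\<^sub>R axis i 1)) 0"

text \<open>Since \<open>deriv\<close> is total, differentiability is demanded explicitly at every order.\<close>

primrec C_k :: "nat \<Rightarrow> (real ^ 'n \<Rightarrow> real) \<Rightarrow> bool" where
  "C_k 0 u \<longleftrightarrow> continuous_on UNIV u"
| "C_k (Suc k) u \<longleftrightarrow> u differentiable_on UNIV \<and> (\<forall>i. C_k k (partial i u))"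

definition smooth :: "(real ^ 'n \<Rightarrow> real) \<Rightarrow> bool" where
  "smooth u \<longleftrightarrow> (\<forall>k. C_k k u)"

text \<open>
  A second order system \<open>x'' + 2 G(x, x', t) = 0\<close> is represented by the function
  \<open>G\<close> of the independent arguments \<open>x\<close>, \<open>y\<close>, \<open>t\<close>.
  In all matrices the upper index is the row and the (first) lower index the column.
\<close>

type_synonym 'n second_order_system = "real ^ 'n \<Rightarrow> real ^ 'n \<Rightarrow> real \<Rightarrow> real ^ 'n"

definition nonlinear_connection ::
    "'n second_order_system \<Rightarrow> real ^ 'n \<Rightarrow> real ^ 'n \<Rightarrow> real \<Rightarrow> real ^ 'n ^ 'n" where
  "nonlinear_connection G x y t = (\<chi> i j. partial j (\<lambda>y'. G x y' t $ i) y)"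

definition berwald_connection ::
    "'n second_order_system \<Rightarrow> real ^ 'n \<Rightarrow> real ^ 'n \<Rightarrow> real \<Rightarrow> 'n \<Rightarrow> 'n \<Rightarrow> 'n \<Rightarrow> real" where
  "berwald_connection G x y t i j l =
     partial l (\<lambda>y'. nonlinear_connection G x y' t $ i $ j) y"

definition deviation_curvature ::
    "('n :: finite) second_order_system \<Rightarrow> real ^ 'n \<Rightarrow> real ^ 'n \<Rightarrow> real \<Rightarrow> real ^ 'n ^ 'n" where
  "deviation_curvature G x y t = (\<chi> i j.
     - 2 * partial j (\<lambda>x'. G x' y t $ i) x
     - 2 * (\<Sum>l\<in>UNIV. G x y t $ l * berwald_connection G x y t i j l)
     + (\<Sum>l\<in>UNIV. y $ l * partial l (\<lambda>x'. nonlinear_connection G x' y t $ i $ j) x)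
     + (\<Sum>l\<in>UNIV. nonlinear_connection G x y t $ i $ l * nonlinear_connection G x y t $ l $ j)
     + deriv (\<lambda>t'. nonlinear_connection G x y t' $ i $ j) t)"

text \<open>
  Differentiating \<open>x' = F(x)\<close> once gives \<open>x'' = DF(x) x'\<close>, that is
  \<open>G(x, y, t) = - DF(x) y / 2\<close>.
\<close>

definition prolongation :: "(real ^ 'n \<Rightarrow> real ^ 'n) \<Rightarrow> ('n :: finite) second_order_system" where
  "prolongation F x y t =
     (\<chi> i. - (1 / 2) * (\<Sum>k\<in>UNIV. partial k (\<lambda>x'. F x' $ i) x * y $ k))"

definition is_eigenvalue :: "complex ^ 'n ^ 'n \<Rightarrow> complex \<Rightarrow> bool" where
  "is_eigenvalue A c \<longleftrightarrow> (\<exists>v. v \<noteq> 0 \<and> A *v v = c *s v)"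

text \<open>
  The notions below are meant for a fixed point \<open>p\<close> of \<open>F\<close>, where \<open>y = F p = 0\<close>.
  The prolongation is autonomous, so the choice of the time \<open>0\<close> is immaterial.
\<close>

definition jacobi_stable :: "(real ^ 'n \<Rightarrow> real ^ 'n) \<Rightarrow> real ^ ('n :: finite) \<Rightarrow> bool" where
  "jacobi_stable F p \<longleftrightarrow>
     (\<forall>c. is_eigenvalue
            (map_matrix complex_of_real (deviation_curvature (prolongation F) p 0 0)) c
          \<longrightarrow> Re c < 0)"

definition jacobi_unstable :: "(real ^ 'n \<Rightarrow> real ^ 'n) \<Rightarrow> real ^ ('n :: finite) \<Rightarrow> bool" where
  "jacobi_unstable F p \<longleftrightarrow> \<not> jacobi_stable F p"

end

theory Submission
  imports Defs
begin

text \<open>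
  At \<open>y = 0\<close> every term of the deviation curvature of a prolongation vanishes except
  \<open>N\<^sup>2\<close>, where \<open>N\<close> is the nonlinear connection, a real matrix.
  In odd dimension \<open>N\<close> has a real eigenvalue \<open>\<mu>\<close>, so \<open>\<mu>\<^sup>2 \<ge> 0\<close> is an eigenvalue of the
  deviation curvature.
\<close>

lemma continuous_on_det:
  fixes A :: "'a :: topological_space \<Rightarrow> real ^ 'n ^ 'n"
  assumes "\<And>i j. continuous_on S (\<lambda>x. A x $ i $ j)"
  shows "continuous_on S (\<lambda>x. det (A x))"
  unfolding det_def by (intro continuous_intros assms)

text \<open>The characteristic polynomial has odd degree, so it takes both signs and has a real root
  \<mu>; a kernel vector of \<mu> I - A is then an eigenvector.\<close>

lemma odd_dimension_real_eigenvector: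
  fixes A :: "real ^ 'n ^ 'n"
  assumes "odd CARD('n)"
  obtains v \<mu> where "v \<noteq> 0" "A *v v = \<mu> *\<^sub>R v"
proof -
  \<comment> \<open>Homogenised characteristic polynomial: its sign for large \<open>r\<close> at
    \<open>s = - 1\<close> can be read off near \<open>s = 0\<close> at \<open>r = 1\<close>, where
    \<open>d 1 0 = det I = 1\<close>.\<close>
  define d where "d r s = det (r *\<^sub>R mat 1 + s *\<^sub>R A)" for r s :: real
  have cont: "continuous_on UNIV (\<lambda>s. d 1 s)" "continuous_on UNIV (\<lambda>r. d r (- 1))"
    unfolding d_def by (rule continuous_on_det; simp; intro continuous_intros)+
  have hom: "d (c * r) (c * s) = c ^ CARD('n) * d r s" for c r s
  proof -
    have "(c * r) *\<^sub>R mat 1 + (c * s) *\<^sub>R A = (\<chi> i. c *s (r *\<^sub>R mat 1 + s *\<^sub>R A) $ i)"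
      by (simp add: vec_eq_iff algebra_simps)
    then show ?thesis
      unfolding d_def by (simp only: det_rows_mul vec_lambda_eta prod_constant)
  qed
  have "open ((\<lambda>s. d 1 s) -` {0<..})"
    using cont(1) by (simp add: continuous_on_open_vimage)
  moreover have "0 \<in> (\<lambda>s. d 1 s) -` {0<..}"
    by (simp add: d_def)
  ultimately obtain e where "e > 0" and e: "cball 0 e \<subseteq> (\<lambda>s. d 1 s) -` {0<..}"
    by (metis open_contains_cball)
  then have pos: "d 1 e > 0" "d 1 (- e) > 0"
    by (auto simp: subset_iff dist_norm)
  \<comment> \<open>Scaling (1, -e) by 1/e and (1, e) by -1/e makes the second argument -1 in both
    cases; the odd power of the negative factor flips the sign.\<close>
  have "d (1 / e) (- 1) = (1 / e) ^ CARD('n) * d 1 (- e)"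
    using hom[of "1 / e" 1 "- e"] \<open>e > 0\<close> by simp
  then have "d (1 / e) (- 1) > 0"
    using pos \<open>e > 0\<close> by simp
  moreover have "d (- (1 / e)) (- 1) = (- (1 / e)) ^ CARD('n) * d 1 e"
    using hom[of "- (1 / e)" 1 e] \<open>e > 0\<close> by simp
  then have "d (- (1 / e)) (- 1) < 0"
    using pos \<open>e > 0\<close> assms by (simp add: power_minus_odd mult_neg_pos)
  moreover have "- (1 / e) \<le> 1 / e"
    using \<open>e > 0\<close> by simp
  ultimately obtain \<mu> where "d \<mu> (- 1) = 0"
    using IVT'[of "\<lambda>r. d r (- 1)" "- (1 / e)" 0 "1 / e"] continuous_on_subset[OF cont(2)]
    by (metis less_imp_le subset_UNIV)
  then have "\<not> invertible (\<mu> *\<^sub>R mat 1 - A)"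
    by (simp add: d_def invertible_det_nz)
  then obtain v where "v \<noteq> 0" "(\<mu> *\<^sub>R mat 1 - A) *v v = 0"
    by (metis invertible_left_inverse matrix_left_invertible_ker)
  then have "v \<noteq> 0" "A *v v = \<mu> *\<^sub>R v"
    by (simp_all add: matrix_vector_mult_diff_rdistrib scaleR_matrix_vector_assoc[symmetric])
  then show thesis
    by (rule that)
qed

text \<open>Bridge to \<open>jacobi_stable\<close>, whose eigenvalues are those of a complex matrix:
  the real eigenvector is embedded coordinatewise.\<close>

lemma is_eigenvalue_complexification:
  fixes A :: "real ^ 'n ^ 'n"
  assumes "v \<noteq> 0" "A *v v = \<mu> *\<^sub>R v"
  shows "is_eigenvalue (map_matrix complex_of_real A) (complex_of_real \<mu>)"
  unfolding is_eigenvalue_def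
proof (intro exI conjI)
  let ?v = "\<chi> i. complex_of_real (v $ i)"
  show "?v \<noteq> 0"
    using assms(1) by (simp add: vec_eq_iff)
  have "(\<Sum>j\<in>UNIV. A $ i $ j * v $ j) = \<mu> * v $ i" for i
    using assms(2) by (simp add: vec_eq_iff matrix_vector_mult_def)
  then show "map_matrix complex_of_real A *v ?v = complex_of_real \<mu> *s ?v"
    by (simp add: vec_eq_iff matrix_vector_mult_def map_matrix_def
        flip: of_real_mult of_real_sum)
qed

lemma prolongation_zero_velocity: "prolongation F x 0 t = 0"
  by (simp add: prolongation_def vec_eq_iff)

text \<open>The first two terms vanish because the prolongation is zero at \<open>y = 0\<close> for
  every \<open>x\<close>, the third by its factor \<open>y\<close>, the last because the system is
  autonomous.\<close>

lemma deviation_curvature_prolongation_zero_velocity: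
  "deviation_curvature (prolongation F) x 0 t =
     nonlinear_connection (prolongation F) x 0 t ** nonlinear_connection (prolongation F) x 0 t"
proof -
  have "nonlinear_connection (prolongation F) x y t' = nonlinear_connection (prolongation F) x y t"
    for y t'
    by (simp add: nonlinear_connection_def prolongation_def)
  then have "deriv (\<lambda>t'. nonlinear_connection (prolongation F) x 0 t' $ i $ j) t = 0" for i j
    by (metis (no_types, lifting) deriv_const ext)
  then show ?thesis
    by (simp add: deviation_curvature_def prolongation_zero_velocity matrix_matrix_mult_def
        partial_def)
qed

theorem odd_dimension_jacobi_unstable:
  fixes F :: "real ^ 'n \<Rightarrow> real ^ ('n :: finite)"
  assumes "odd CARD('n)"
  shows "jacobi_unstable F p"
proof -
  let ?N = "nonlinear_connection (prolongation F) p 0 0"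
  obtain v \<mu> where v: "v \<noteq> 0" "?N *v v = \<mu> *\<^sub>R v"
    using odd_dimension_real_eigenvector[OF assms] .
  then have "(?N ** ?N) *v v = \<mu>\<^sup>2 *\<^sub>R v"
    by (simp add: matrix_vector_mul_assoc[symmetric] matrix_vector_mult_scaleR power2_eq_square)
  then have "is_eigenvalue
      (map_matrix complex_of_real (deviation_curvature (prolongation F) p 0 0))
      (complex_of_real (\<mu>\<^sup>2))"
    using is_eigenvalue_complexification v(1)
    by (metis deviation_curvature_prolongation_zero_velocity)
  \<comment> \<open>This covers \<mu> = 0 too: stability demands strictly negative real
    parts.\<close>
  moreover have "\<not> Re (complex_of_real (\<mu>\<^sup>2)) < 0"
    by (simp only: Re_complex_of_real not_less zero_le_power2)
  ultimately show ?thesis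
    unfolding jacobi_unstable_def jacobi_stable_def by blast
qed

theorem theorem3:
  fixes f g h :: "real ^ 3 \<Rightarrow> real"
  assumes "smooth f" and "smooth g" and "smooth h"
    and "f 0 = 0" and "g 0 = 0" and "h 0 = 0"
  shows "jacobi_unstable (\<lambda>x. vector [f x, g x, h x]) 0"
  \<comment> \<open>What is left for \<open>simp\<close> is that \<open>CARD(3)\<close> is
    odd.\<close>
  by (rule odd_dimension_jacobi_unstable) simp

end
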